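(* Let $V$ be an optimal computer and let $M$ be a deterministic Turing machine which computes $V$. Then $n=H(T^M_n,n)+O(1)=H(T^M_n)+O(1)$ for all $n\ge L_M$; that is, there is a constant $C$ such that $|n-H(T^M_n,n)|\le C$ and $|n-H(T^M_n)|\le C$ for all integers $n\ge L_M$.
   Context: $\{0,1\}^*$ is the set of finite binary strings, ordered $\lambda,0,1,00,01,\dots$, and natural numbers are identified with strings via this order (the $n$th string). A computer is a partial recursive function $C\colon\{0,1\}^*\to\{0,1\}^*$ with prefix-free domain $\mathrm{Dom}\,C$. A computer $U$ is optimal if for every computer $C$ there is $d\in\mathbb{N}$ such that for every $p\in\mathrm{Dom}\,C$ there is $q$ with $U(q)=C(p)$ and $|q|\le|p|+d$. Fix an optimal computer $U$; $H(s)=\min\{|p|:U(p)=s\}$, and $H(s,t)=H(b(s,t))$ for a fixed bijective total recursive $b\colon\{0,1\}^*\times\{0,1\}^*\to\{0,1\}^*$. A deterministic Turing machine $M$ computes a computer $V$ if for every input $p$: $M$ halts and outputs $V(p)$ when $p\in\mathrm{Dom}\,V$, and $M$ never halts otherwise. $L_M=\min\{|p|: M\text{ halts on input }p\}$, and for $n\ge L_M$, $T^M_n$ is the maximum running time of $M$ over all halting inputs of length at most $n$. *)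

theory Defs
  imports Complex_Main "HOL-Library.Sublist"
begin

section \<open>Binary strings and natural numbers\<close>

text \<open>Bits are booleans (0 is \<open>False\<close>, 1 is \<open>True\<close>), so a binary string is a \<open>bool list\<close>.
  The position of a string in the length-lexicographic order
  \<open>[], 0, 1, 00, 01, \<dots>\<close> (counted from 0) is its value in bijective base 2, most significant
  digit first: the digit is 1 for bit 0 and 2 for bit 1.\<close>

definition str_index :: "bool list \<Rightarrow> nat" where
  "str_index s = foldl (\<lambda>n d. 2 * n + (if d then 2 else 1)) 0 s"

definition nth_str :: "nat \<Rightarrow> bool list" where
  "nth_str = inv str_index"

lemma str_index_Nil [simp]: "str_index [] = 0"
  by (simp add: str_index_def)

lemma str_index_snoc [simp]: "str_index (s @ [d]) = 2 * str_index s + (if d then 2 else 1)"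
  by (simp add: str_index_def)

lemma inj_str_index: "inj str_index"
proof (rule injI)
  show "str_index s = str_index t \<Longrightarrow> s = t" for s t
  proof (induction s arbitrary: t rule: rev_induct)
    case Nil
    then show ?case
      by (cases t rule: rev_cases) (auto split: if_splits)
  next
    case (snoc d s)
    show ?case
    proof (cases t rule: rev_cases)
      case Nil
      then show ?thesis using snoc.prems by (auto split: if_splits)
    next
      case (snoc t' d')
      have eq: "2 * str_index s + (if d then 2 else 1) = 2 * str_index t' + (if d' then 2 else 1)"
        using snoc.prems snoc by simp
      have "d = d'"
        using eq by (cases d; cases d'; simp; presburger)
      moreover have "str_index s = str_index t'"
        using eq calculation by simp
      ultimately show ?thesis
        using snoc.IH snoc by simp
    qed
  qed
qed

lemma surj_str_index: "surj str_index"
proof -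
  have "\<exists>s. str_index s = n" for n
  proof (induction n rule: less_induct)
    case (less n)
    show ?case
    proof (cases "n = 0")
      case True
      then show ?thesis by (intro exI[of _ "[]"]) simp
    next
      case False
      then have "(n - 1) div 2 < n" by simp
      then obtain s where s: "str_index s = (n - 1) div 2"
        using less by blast
      show ?thesis
      proof (cases "even n")
        case True
        then have "str_index (s @ [True]) = n"
          using s False by (simp; presburger)
        then show ?thesis by blast
      next
        case odd: False
        then have "str_index (s @ [False]) = n"
          using s by (simp; presburger)
        then show ?thesis by blast
      qed
    qed
  qed
  then show ?thesis by (metis surjI)
qed

lemma bij_str_index: "bij str_index"
  by (simp add: bij_def inj_str_index surj_str_index)

lemma str_index_nth_str [simp]: "str_index (nth_str n) = n"
  by (simp add: nth_str_def surj_f_inv_f[OF surj_str_index])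

lemma nth_str_str_index [simp]: "nth_str (str_index s) = s"
  by (simp add: nth_str_def inj_str_index)


section \<open>Partial recursive functions\<close>

text \<open>Kleene's partial recursive functions. Terms carry no arity: a term denotes, for each
  \<open>k\<close>, a partial recursive function of the argument lists of length \<open>k\<close>
  (undefined where the arity does not fit).\<close>

datatype recf =
    Zero
  | Succ
  | Proj nat
  | Comp recf "recf list"
  | PrimRec recf recf
  | Mu recf

text \<open>In \<open>PrimRec\<close> the recursion argument comes first and the step term receives the
  recursion index, the previous value and the parameters. \<open>Mu f\<close> searches for the least
  zero of \<open>f\<close> in its first argument and requires \<open>f\<close> to be defined at all
  smaller values.\<close>

fun rec_eval :: "recf \<Rightarrow> nat list \<Rightarrow> nat option" where
  "rec_eval Zero xs = Some 0"
| "rec_eval Succ xs = (case xs of [x] \<Rightarrow> Some (Suc x) | _ \<Rightarrow> None)"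
| "rec_eval (Proj i) xs = (if i < length xs then Some (xs ! i) else None)"
| "rec_eval (Comp f gs) xs =
     (let ys = map (\<lambda>g. rec_eval g xs) gs
      in if None \<in> set ys then None else rec_eval f (map the ys))"
| "rec_eval (PrimRec f g) xs =
     (case xs of
        [] \<Rightarrow> None
      | n # zs \<Rightarrow>
          rec_nat (rec_eval f zs) (\<lambda>k r. Option.bind r (\<lambda>y. rec_eval g (k # y # zs))) n)"
| "rec_eval (Mu f) xs =
     (if \<exists>n. rec_eval f (n # xs) = Some 0 \<and> (\<forall>m<n. \<exists>v>0. rec_eval f (m # xs) = Some v)
      then Some (LEAST n. rec_eval f (n # xs) = Some 0)
      else None)"

definition partial_recursive :: "(bool list \<rightharpoonup> bool list) \<Rightarrow> bool" where
  "partial_recursive C \<longleftrightarrow>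
     (\<exists>e. \<forall>p. rec_eval e [str_index p] = map_option str_index (C p))"

definition total_recursive2 :: "(bool list \<times> bool list \<Rightarrow> bool list) \<Rightarrow> bool" where
  "total_recursive2 b \<longleftrightarrow>
     (\<exists>e. \<forall>s t. rec_eval e [str_index s, str_index t] = Some (str_index (b (s, t))))"


section \<open>Computers and program-size complexity\<close>

definition prefix_free :: "bool list set \<Rightarrow> bool" where
  "prefix_free A \<longleftrightarrow> (\<forall>p\<in>A. \<forall>q\<in>A. prefix p q \<longrightarrow> p = q)"

definition computer :: "(bool list \<rightharpoonup> bool list) \<Rightarrow> bool" where
  "computer C \<longleftrightarrow> partial_recursive C \<and> prefix_free (dom C)"

definition optimal :: "(bool list \<rightharpoonup> bool list) \<Rightarrow> bool" where
  "optimal U \<longleftrightarrow> computer U \<and>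
     (\<forall>C. computer C \<longrightarrow>
        (\<exists>d. \<forall>p\<in>dom C. \<exists>q. U q = C p \<and> length q \<le> length p + d))"

definition complexity :: "(bool list \<rightharpoonup> bool list) \<Rightarrow> bool list \<Rightarrow> nat" where
  "complexity U s = (LEAST k. \<exists>p. U p = Some s \<and> length p = k)"

definition pair_complexity ::
  "(bool list \<rightharpoonup> bool list) \<Rightarrow> (bool list \<times> bool list \<Rightarrow> bool list) \<Rightarrow>
   bool list \<Rightarrow> bool list \<Rightarrow> nat" where
  "pair_complexity U b s t = complexity U (b (s, t))"


section \<open>Deterministic Turing machines\<close>

text \<open>Machines have one two-way infinite tape, a finite set of states and a finite set of
  auxiliary tape symbols; finiteness is imposed by the class \<open>finite\<close> on the type
  parameters where machines are quantified over. A machine halts when its transition function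
  is undefined.\<close>

datatype 'g symbol = Blank | Bit bool | Aux 'g

datatype move = MoveLeft | Stay | MoveRight

record ('q, 'g) tm =
  tm_start :: 'q
  tm_delta :: "'q \<Rightarrow> 'g symbol \<Rightarrow> ('q \<times> 'g symbol \<times> move) option"

type_synonym ('q, 'g) config = "'q \<times> (int \<Rightarrow> 'g symbol) \<times> int"

definition tm_init :: "('q, 'g) tm \<Rightarrow> bool list \<Rightarrow> ('q, 'g) config" where
  "tm_init M p =
     (tm_start M,
      (\<lambda>i. if 0 \<le> i \<and> i < int (length p) then Bit (p ! nat i) else Blank),
      0)"

fun offset :: "move \<Rightarrow> int" where
  "offset MoveLeft = - 1"
| "offset Stay = 0"
| "offset MoveRight = 1"

fun tm_step :: "('q, 'g) tm \<Rightarrow> ('q, 'g) config \<Rightarrow> ('q, 'g) config option" where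
  "tm_step M (q, tape, h) =
     map_option (\<lambda>(q', a, m). (q', tape(h := a), h + offset m)) (tm_delta M q (tape h))"

primrec tm_run :: "('q, 'g) tm \<Rightarrow> bool list \<Rightarrow> nat \<Rightarrow> ('q, 'g) config option" where
  "tm_run M p 0 = Some (tm_init M p)"
| "tm_run M p (Suc k) = Option.bind (tm_run M p k) (tm_step M)"

definition halts_with :: "('q, 'g) tm \<Rightarrow> bool list \<Rightarrow> nat \<Rightarrow> ('q, 'g) config \<Rightarrow> bool" where
  "halts_with M p k c \<longleftrightarrow> tm_run M p k = Some c \<and> tm_step M c = None"

definition halts :: "('q, 'g) tm \<Rightarrow> bool list \<Rightarrow> bool" where
  "halts M p \<longleftrightarrow> (\<exists>k c. halts_with M p k c)"

lemma halts_with_unique: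
  assumes "halts_with M p k c" "halts_with M p k' c'"
  shows "k = k' \<and> c = c'"
proof -
  have dead: "tm_run M p (Suc (i + j)) = None" if "halts_with M p i d" for i j d
    using that by (induction j) (auto simp: halts_with_def)
  have "\<not> i < j" if "halts_with M p i d" "halts_with M p j d'" for i j d d'
  proof
    assume "i < j"
    then obtain l where "j = Suc (i + l)"
      by (auto simp: less_iff_Suc_add)
    then show False
      using dead[OF that(1), of l] that(2) by (simp add: halts_with_def)
  qed
  from this[OF assms] this[OF assms(2,1)] have "k = k'" by simp
  then show ?thesis using assms by (auto simp: halts_with_def)
qed

text \<open>The output is the maximal block of bits that starts at the cell under the head.\<close>

fun outputs :: "('q, 'g) config \<Rightarrow> bool list \<Rightarrow> bool" where
  "outputs (q, tape, h) s \<longleftrightarrow>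
     (\<forall>i<length s. tape (h + int i) = Bit (s ! i)) \<and>
     (\<forall>d. tape (h + int (length s)) \<noteq> Bit d)"

definition computes :: "('q, 'g) tm \<Rightarrow> (bool list \<rightharpoonup> bool list) \<Rightarrow> bool" where
  "computes M V \<longleftrightarrow>
     (\<forall>p. case V p of
            Some s \<Rightarrow> \<exists>k c. halts_with M p k c \<and> outputs c s
          | None \<Rightarrow> \<not> halts M p)"

definition running_time :: "('q, 'g) tm \<Rightarrow> bool list \<Rightarrow> nat" where
  "running_time M p = (THE k. \<exists>c. halts_with M p k c)"

definition min_halting_length :: "('q, 'g) tm \<Rightarrow> nat" where
  "min_halting_length M = (LEAST l. \<exists>p. halts M p \<and> length p = l)"

definition max_running_time :: "('q, 'g) tm \<Rightarrow> nat \<Rightarrow> nat" where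
  "max_running_time M n = Max (running_time M ` {p. halts M p \<and> length p \<le> n})"

end

theory Submission
  imports Defs "HOL-Library.Nat_Bijection" "HOL-Library.Countable"
begin

text \<open>Upper bounds: from a program \<open>p\<close> of length at most \<open>n\<close> on which \<open>M\<close> runs longest, one
  computes \<open>T\<^sub>n\<close> by simulating \<open>M\<close>, so \<open>H(T\<^sub>n) \<le> |p| + O(1) \<le> n + O(1)\<close>.

  Lower bounds: a prefix-free machine must read its whole input, so \<open>T\<^sub>n\<close> bounds both the length
  and the running time of every halting program of length at most \<open>n\<close>. Hence from \<open>T\<^sub>n\<close> alone,
  or from the code of \<open>(T\<^sub>n, n)\<close>, one computes a string beyond all outputs of these programs. Its
  complexity exceeds \<open>n\<close>, so \<open>n \<le> H(T\<^sub>n) + O(1)\<close> and \<open>n \<le> H(T\<^sub>n, n) + O(1)\<close>.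

  These two bounds on \<open>H(T\<^sub>n)\<close> leave only finitely many values for \<open>j = n - |p|\<close>. Each \<open>j\<close> gives a
  computer that maps \<open>p\<close> to the code of \<open>(T\<^sub>n, |p| + j)\<close>, whence \<open>H(T\<^sub>n, n) \<le> n + O(1)\<close>.\<close>

section \<open>Total recursive functions and predicates\<close>

named_theorems recfn_intros

text \<open>Only the values on lists of length \<open>k\<close> matter, so arguments can be written
  as \<open>xs ! i\<close>. The closure rules collected in \<open>recfn_intros\<close> then follow
  the shape of the expression.\<close>

definition recfn :: "nat \<Rightarrow> (nat list \<Rightarrow> nat) \<Rightarrow> bool" where
  "recfn k f \<longleftrightarrow> (\<exists>e. \<forall>xs. length xs = k \<longrightarrow> rec_eval e xs = Some (f xs))"

definition recpred :: "nat \<Rightarrow> (nat list \<Rightarrow> bool) \<Rightarrow> bool" where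
  "recpred k P \<longleftrightarrow> recfn k (\<lambda>xs. of_bool (P xs))"

lemma recfn_cong:
  assumes "\<And>xs. length xs = k \<Longrightarrow> f xs = g xs" and "recfn k g"
  shows "recfn k f"
  using assms unfolding recfn_def by simp

lemma recpred_cong:
  assumes "\<And>xs. length xs = k \<Longrightarrow> P xs = Q xs" and "recpred k Q"
  shows "recpred k P"
  using assms unfolding recpred_def recfn_def by simp

lemma recfn_nth [recfn_intros]: "i < k \<Longrightarrow> recfn k (\<lambda>xs. xs ! i)"
  unfolding recfn_def by (rule exI[of _ "Proj i"]) auto

lemma recfn_comp:
  assumes f: "recfn n f" and n: "length gs = n" and gs: "\<And>g. g \<in> set gs \<Longrightarrow> recfn k g"
  shows "recfn k (\<lambda>xs. f (map (\<lambda>g. g xs) gs))"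
proof -
  obtain ef where ef: "\<And>xs. length xs = n \<Longrightarrow> rec_eval ef xs = Some (f xs)"
    using f unfolding recfn_def by blast
  have "\<forall>g\<in>set gs. \<exists>e. \<forall>xs. length xs = k \<longrightarrow> rec_eval e xs = Some (g xs)"
    using gs unfolding recfn_def by blast
  then obtain E where E: "\<And>g xs. g \<in> set gs \<Longrightarrow> length xs = k \<Longrightarrow> rec_eval (E g) xs = Some (g xs)"
    by metis
  have "rec_eval (Comp ef (map E gs)) xs = Some (f (map (\<lambda>g. g xs) gs))" if "length xs = k" for xs
  proof -
    have eval: "map (\<lambda>g. rec_eval g xs) (map E gs) = map (\<lambda>g. Some (g xs)) gs"
      using E that by simp
    have the: "map the (map (\<lambda>g. Some (g xs)) gs) = map (\<lambda>g. g xs) gs"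
      by simp
    have none: "None \<notin> set (map (\<lambda>g. Some (g xs)) gs)"
      by auto
    show ?thesis
      unfolding rec_eval.simps(4) Let_def eval the using none ef n by simp
  qed
  then show ?thesis unfolding recfn_def by blast
qed

lemma recfn_comp1:
  assumes "recfn 1 (\<lambda>xs. h (xs ! 0))" "recfn k f"
  shows "recfn k (\<lambda>xs. h (f xs))"
  using recfn_comp[OF assms(1), of "[f]" k] assms(2) by simp

lemma recfn_comp2:
  assumes "recfn 2 (\<lambda>xs. h (xs ! 0) (xs ! 1))" "recfn k f" "recfn k g"
  shows "recfn k (\<lambda>xs. h (f xs) (g xs))"
  using recfn_comp[OF assms(1), of "[f, g]" k] assms(2,3) by auto

text \<open>Composition with \<open>a\<close> and all \<open>k\<close> projections. It substitutes
  an arbitrary function for the recursion argument, which \<open>PrimRec\<close> keeps in first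
  place.\<close>

lemma recfn_Cons:
  assumes "recfn (Suc k) f" "recfn k a"
  shows "recfn k (\<lambda>xs. f (a xs # xs))"
proof (rule recfn_cong)
  show "recfn k (\<lambda>xs. f (map (\<lambda>g. g xs) (a # map (\<lambda>i xs. xs ! i) [0..<k])))"
    by (rule recfn_comp[OF assms(1)]) (use assms(2) in \<open>auto intro: recfn_nth\<close>)
  show "f (a xs # xs) = f (map (\<lambda>g. g xs) (a # map (\<lambda>i xs. xs ! i) [0..<k]))"
    if "length xs = k" for xs
    using that map_nth[of xs] by (simp add: comp_def)
qed

lemma recfn_Suc [recfn_intros]: "recfn k f \<Longrightarrow> recfn k (\<lambda>xs. Suc (f xs))"
proof (rule recfn_comp1[where h = Suc])
  have "rec_eval Succ xs = Some (Suc (xs ! 0))" if "length xs = 1" for xs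
    using that by (cases xs) auto
  then show "recfn 1 (\<lambda>xs. Suc (xs ! 0))"
    unfolding recfn_def by blast
qed

lemma recfn_const [recfn_intros]: "recfn k (\<lambda>xs. c)"
proof (induction c)
  case 0
  show ?case unfolding recfn_def by (rule exI[of _ Zero]) auto
qed (rule recfn_Suc)

lemma recfn_rec_nat:
  assumes f: "recfn k f" and g: "recfn (Suc (Suc k)) g" and n: "recfn k n"
  shows "recfn k (\<lambda>xs. rec_nat (f xs) (\<lambda>i r. g (i # r # xs)) (n xs))"
proof -
  obtain ef where ef: "\<And>xs. length xs = k \<Longrightarrow> rec_eval ef xs = Some (f xs)"
    using f unfolding recfn_def by blast
  obtain eg where eg: "\<And>xs. length xs = Suc (Suc k) \<Longrightarrow> rec_eval eg xs = Some (g xs)"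
    using g unfolding recfn_def by blast
  let ?h = "\<lambda>ys. rec_nat (f (tl ys)) (\<lambda>i r. g (i # r # tl ys)) (hd ys)"
  have "rec_eval (PrimRec ef eg) ys = Some (?h ys)" if ys: "length ys = Suc k" for ys
  proof -
    obtain m zs where [simp]: "ys = m # zs" and zs: "length zs = k"
      using ys by (cases ys) auto
    have "rec_nat (rec_eval ef zs) (\<lambda>k r. Option.bind r (\<lambda>y. rec_eval eg (k # y # zs))) m =
        Some (rec_nat (f zs) (\<lambda>i r. g (i # r # zs)) m)"
      by (induction m) (auto simp: ef eg zs)
    then show ?thesis by simp
  qed
  then have "recfn (Suc k) ?h"
    unfolding recfn_def by blast
  from recfn_Cons[OF this n] show ?thesis by simp
qed

lemma recfn_funpow:
  assumes "recfn 1 (\<lambda>xs. h (xs ! 0))" "recfn k n" "recfn k f"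
  shows "recfn k (\<lambda>xs. (h ^^ n xs) (f xs))"
proof (rule recfn_cong)
  show "recfn k (\<lambda>xs. rec_nat (f xs) (\<lambda>i r. (\<lambda>ys. h (ys ! 1)) (i # r # xs)) (n xs))"
    using assms by (intro recfn_rec_nat[where g = "\<lambda>ys. h (ys ! 1)"] recfn_comp1[OF assms(1)] recfn_nth) simp_all
  show "(h ^^ n xs) (f xs) = rec_nat (f xs) (\<lambda>i r. (\<lambda>ys. h (ys ! 1)) (i # r # xs)) (n xs)" for xs
  proof -
    have "(h ^^ m) x = rec_nat x (\<lambda>i r. h r) m" for m x
      by (induction m) auto
    then show ?thesis by simp
  qed
qed

section \<open>Arithmetic and Boolean operations\<close>

lemma recfn_add [recfn_intros]:
  assumes "recfn k f" "recfn k g" shows "recfn k (\<lambda>xs. f xs + g xs)"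
proof (rule recfn_cong)
  show "recfn k (\<lambda>xs. (Suc ^^ g xs) (f xs))"
    using assms by (intro recfn_funpow recfn_intros) simp_all
  show "f xs + g xs = (Suc ^^ g xs) (f xs)" for xs
    by simp
qed

lemma recfn_diff [recfn_intros]:
  assumes "recfn k f" "recfn k g" shows "recfn k (\<lambda>xs. f xs - g xs)"
proof (rule recfn_cong)
  \<comment> \<open>The predecessor is the recursion whose step returns its index; truncated
    subtraction iterates it.\<close>
  have "recfn 1 (\<lambda>xs. rec_nat ((\<lambda>_. 0) xs) (\<lambda>i r. (\<lambda>ys. ys ! 0) (i # r # xs)) (xs ! 0))"
    by (intro recfn_rec_nat[where g = "\<lambda>ys. ys ! 0"] recfn_intros) simp_all
  then have "recfn 1 (\<lambda>xs. xs ! 0 - 1)"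
  proof (rule recfn_cong[rotated])
    show "xs ! 0 - 1 = rec_nat ((\<lambda>_. 0) xs) (\<lambda>i r. (\<lambda>ys. ys ! 0) (i # r # xs)) (xs ! 0)"
      for xs :: "nat list"
      by (cases "xs ! 0") auto
  qed
  then show "recfn k (\<lambda>xs. ((\<lambda>n. n - 1) ^^ g xs) (f xs))"
    using assms by (intro recfn_funpow recfn_intros) simp_all
  have "((\<lambda>n. n - 1) ^^ j) i = i - j" for i j :: nat
    by (induction j) auto
  then show "f xs - g xs = ((\<lambda>n. n - 1) ^^ g xs) (f xs)" for xs
    by simp
qed

lemma recfn_mult [recfn_intros]:
  assumes "recfn k f" "recfn k g" shows "recfn k (\<lambda>xs. f xs * g xs)"
proof (rule recfn_comp2[where h = "\<lambda>x y. x * y", OF _ assms], rule recfn_cong)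
  show "recfn 2 (\<lambda>xs. rec_nat ((\<lambda>_. 0) xs) (\<lambda>i r. (\<lambda>ys. ys ! 1 + ys ! 2) (i # r # xs)) (xs ! 1))"
    by (intro recfn_rec_nat[where g = "\<lambda>ys. ys ! 1 + ys ! 2"] recfn_intros) simp_all
  have "rec_nat 0 (\<lambda>i r. r + x) y = x * y" for x y :: nat
    by (induction y) auto
  then show "xs ! 0 * xs ! 1 =
      rec_nat ((\<lambda>_. 0) xs) (\<lambda>i r. (\<lambda>ys. ys ! 1 + ys ! 2) (i # r # xs)) (xs ! 1)" for xs :: "nat list"
    by simp
qed

lemma recfn_power [recfn_intros]:
  assumes "recfn k f" "recfn k g" shows "recfn k (\<lambda>xs. f xs ^ g xs)"
proof (rule recfn_comp2[where h = "\<lambda>x y. x ^ y", OF _ assms], rule recfn_cong)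
  show "recfn 2 (\<lambda>xs. rec_nat ((\<lambda>_. 1) xs) (\<lambda>i r. (\<lambda>ys. ys ! 1 * ys ! 2) (i # r # xs)) (xs ! 1))"
    by (intro recfn_rec_nat[where g = "\<lambda>ys. ys ! 1 * ys ! 2"] recfn_intros) simp_all
  have "rec_nat 1 (\<lambda>i r. r * x) y = x ^ y" for x y :: nat
    by (induction y) auto
  then show "xs ! 0 ^ xs ! 1 =
      rec_nat ((\<lambda>_. 1) xs) (\<lambda>i r. (\<lambda>ys. ys ! 1 * ys ! 2) (i # r # xs)) (xs ! 1)" for xs :: "nat list"
    by simp
qed

lemma recpred_le [recfn_intros]:
  assumes "recfn k f" "recfn k g" shows "recpred k (\<lambda>xs. f xs \<le> g xs)"
  unfolding recpred_def
proof (rule recfn_cong)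
  show "recfn k (\<lambda>xs. 1 - (f xs - g xs))" using assms by (intro recfn_intros)
qed auto

lemma recpred_not [recfn_intros]:
  assumes "recpred k P" shows "recpred k (\<lambda>xs. \<not> P xs)"
  unfolding recpred_def
proof (rule recfn_cong)
  show "recfn k (\<lambda>xs. 1 - of_bool (P xs))" using assms unfolding recpred_def by (intro recfn_intros)
qed auto

lemma recpred_conj [recfn_intros]:
  assumes "recpred k P" "recpred k Q" shows "recpred k (\<lambda>xs. P xs \<and> Q xs)"
  unfolding recpred_def
proof (rule recfn_cong)
  show "recfn k (\<lambda>xs. of_bool (P xs) * of_bool (Q xs))" using assms unfolding recpred_def by (intro recfn_intros)
qed auto

lemma recpred_less [recfn_intros]:
  assumes "recfn k f" "recfn k g" shows "recpred k (\<lambda>xs. f xs < g xs)"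
  using recpred_le[OF recfn_Suc[OF assms(1)] assms(2)] by (simp add: Suc_le_eq)

lemma recpred_eq [recfn_intros]:
  assumes "recfn k f" "recfn k g" shows "recpred k (\<lambda>xs. f xs = g xs)"
  by (rule recpred_cong[OF _ recpred_conj[OF recpred_le[OF assms] recpred_le[OF assms(2,1)]]]) auto

lemma recfn_If [recfn_intros]:
  assumes "recpred k P" "recfn k f" "recfn k g"
  shows "recfn k (\<lambda>xs. if P xs then f xs else g xs)"
proof (rule recfn_cong)
  show "recfn k (\<lambda>xs. of_bool (P xs) * f xs + of_bool (\<not> P xs) * g xs)"
    using assms(2,3) recpred_not[OF assms(1)] assms(1) unfolding recpred_def by (intro recfn_intros)
qed auto

section \<open>Bounded sums, bounded quantifiers and minimization\<close>

lemma recfn_sum: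
  assumes "recfn (Suc k) f" "recfn k n"
  shows "recfn k (\<lambda>xs. \<Sum>i<n xs. f (i # xs))"
proof (rule recfn_cong)
  \<comment> \<open>The recursion step also receives the accumulator, at position 1, which is not an
    argument of \<open>f\<close>; projections drop it.\<close>
  have "recfn (Suc (Suc k)) (\<lambda>ys. f (map (\<lambda>g. g ys) ((\<lambda>ys. ys ! 0) # map (\<lambda>i ys. ys ! Suc (Suc i)) [0..<k])))"
    by (rule recfn_comp[OF assms(1)]) (auto intro: recfn_nth)
  then have "recfn (Suc (Suc k)) (\<lambda>ys. f (ys ! 0 # tl (tl ys)))"
  proof (rule recfn_cong[rotated])
    fix ys :: "nat list" assume "length ys = Suc (Suc k)"
    then obtain a b zs where ys: "ys = a # b # zs" "length zs = k"
      by (metis length_Suc_conv)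
    then show "f (ys ! 0 # tl (tl ys)) =
        f (map (\<lambda>g. g ys) ((\<lambda>ys. ys ! 0) # map (\<lambda>i ys. ys ! Suc (Suc i)) [0..<k]))"
      using map_nth[of zs] by (simp add: comp_def)
  qed
  then have *: "recfn (Suc (Suc k)) (\<lambda>ys. ys ! 1 + f (ys ! 0 # tl (tl ys)))"
    by (intro recfn_intros) simp_all
  show "recfn k (\<lambda>xs. rec_nat ((\<lambda>_. 0) xs) (\<lambda>i r. (\<lambda>ys. ys ! 1 + f (ys ! 0 # tl (tl ys))) (i # r # xs)) (n xs))"
    by (rule recfn_rec_nat[OF recfn_const * assms(2)])
  have "rec_nat 0 (\<lambda>i r. r + f (i # xs)) m = (\<Sum>i<m. f (i # xs))" for m xs
    by (induction m) auto
  then show "(\<Sum>i<n xs. f (i # xs)) =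
      rec_nat ((\<lambda>_. 0) xs) (\<lambda>i r. (\<lambda>ys. ys ! 1 + f (ys ! 0 # tl (tl ys))) (i # r # xs)) (n xs)" for xs
    by simp
qed

text \<open>The truth values below the bound are summed; the sum is positive iff one of them is
  1.\<close>

lemma recpred_ex_less:
  assumes "recpred (Suc k) P" "recfn k n"
  shows "recpred k (\<lambda>xs. \<exists>i<n xs. P (i # xs))"
proof (rule recpred_cong)
  show "recpred k (\<lambda>xs. 0 < (\<Sum>i<n xs. of_bool (P (i # xs)) :: nat))"
    by (rule recpred_less[OF recfn_const recfn_sum[OF assms(1)[unfolded recpred_def] assms(2)]])
  show "(\<exists>i<n xs. P (i # xs)) \<longleftrightarrow> 0 < (\<Sum>i<n xs. of_bool (P (i # xs)) :: nat)" for xs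
    by (subst zero_less_iff_neq_zero, subst sum_eq_0_iff) auto
qed

text \<open>\<open>Mu\<close> looks for a zero, so it is applied to the truth value of the negation.
  That function is total, hence the definedness demanded at smaller values is automatic.\<close>

lemma rec_eval_Mu_recpred:
  assumes "recpred (Suc k) P"
  shows "\<exists>e. \<forall>xs. length xs = k \<longrightarrow>
    rec_eval e xs = (if \<exists>y. P (y # xs) then Some (LEAST y. P (y # xs)) else None)"
proof -
  have "recfn (Suc k) (\<lambda>xs. of_bool (\<not> P xs))"
    using recpred_not[OF assms] unfolding recpred_def .
  then obtain e where e: "\<And>xs. length xs = Suc k \<Longrightarrow> rec_eval e xs = Some (of_bool (\<not> P xs))"
    unfolding recfn_def by blast
  have "rec_eval (Mu e) xs = (if \<exists>y. P (y # xs) then Some (LEAST y. P (y # xs)) else None)"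
    if "length xs = k" for xs
  proof -
    have zero: "rec_eval e (y # xs) = Some 0 \<longleftrightarrow> P (y # xs)" for y
      using e[of "y # xs"] that by simp
    have pos: "(\<exists>v>0. rec_eval e (y # xs) = Some v) \<longleftrightarrow> \<not> P (y # xs)" for y
      using e[of "y # xs"] that by simp
    have "(\<exists>y. P (y # xs) \<and> (\<forall>m<y. \<not> P (m # xs))) \<longleftrightarrow> (\<exists>y. P (y # xs))"
      using exists_least_iff[of "\<lambda>y. P (y # xs)"] by simp
    then show ?thesis
      by (simp only: rec_eval.simps zero pos)
  qed
  then show ?thesis by blast
qed

lemma recfn_Least:
  assumes "recpred (Suc k) P" and "\<And>xs. length xs = k \<Longrightarrow> \<exists>y. P (y # xs)"
  shows "recfn k (\<lambda>xs. LEAST y. P (y # xs))"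
  using rec_eval_Mu_recpred[OF assms(1)] assms(2) unfolding recfn_def by force

text \<open>Searching for the unique point of the graph computes \<open>f\<close>. Division,
  unpairing and string length are obtained in this way.\<close>

lemma recfn_graph:
  assumes "recpred (Suc k) P" and "\<And>y xs. length xs = k \<Longrightarrow> P (y # xs) \<longleftrightarrow> y = f xs"
  shows "recfn k f"
proof (rule recfn_cong)
  show "recfn k (\<lambda>xs. LEAST y. P (y # xs))"
    by (rule recfn_Least) (use assms in auto)
qed (simp add: assms(2) Least_equality)

lemma recfn_div [recfn_intros]:
  assumes "recfn k f" "recfn k g" shows "recfn k (\<lambda>xs. f xs div g xs)"
proof (rule recfn_comp2[where h = "\<lambda>x y. x div y", OF _ assms], rule recfn_graph)
  \<comment> \<open>A disjunction in De Morgan form, since the closure rules cover negation and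
    conjunction. Its first case is division by 0, with value 0.\<close>
  show "recpred (Suc 2) (\<lambda>xs. \<not> (\<not> (xs ! 2 = 0 \<and> xs ! 0 = 0) \<and>
      \<not> (xs ! 0 * xs ! 2 \<le> xs ! 1 \<and> xs ! 1 < Suc (xs ! 0) * xs ! 2)))"
    by (intro recfn_intros) simp_all
  have "\<not> (\<not> (b = 0 \<and> y = 0) \<and> \<not> (y * b \<le> a \<and> a < Suc y * b)) \<longleftrightarrow> y = a div b" for a b y :: nat
    by (cases "b = 0") (auto simp: div_nat_eqI mult.commute dividend_less_times_div)
  then show "\<not> (\<not> ((y # xs) ! 2 = 0 \<and> (y # xs) ! 0 = 0) \<and>
      \<not> ((y # xs) ! 0 * (y # xs) ! 2 \<le> (y # xs) ! 1 \<and> (y # xs) ! 1 < Suc ((y # xs) ! 0) * (y # xs) ! 2))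
      \<longleftrightarrow> y = xs ! 0 div xs ! 1" for y and xs :: "nat list"
    by simp
qed

lemma recfn_mod [recfn_intros]:
  assumes "recfn k f" "recfn k g" shows "recfn k (\<lambda>xs. f xs mod g xs)"
  unfolding modulo_nat_def using assms by (intro recfn_intros)

section \<open>Pairing and finite tables\<close>

lemma recfn_prod_encode [recfn_intros]:
  assumes "recfn k f" "recfn k g" shows "recfn k (\<lambda>xs. prod_encode (f xs, g xs))"
  unfolding prod_encode_def triangle_def prod.case using assms by (intro recfn_intros)

lemma prod_encode_eq_iff: "prod_encode (x, y) = z \<longleftrightarrow> x = fst (prod_decode z) \<and> y = snd (prod_decode z)"
  by (metis fst_conv prod.collapse prod_decode_inverse prod_encode_inverse snd_conv)

lemma recfn_fst_prod_decode [recfn_intros]: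
  assumes "recfn k f" shows "recfn k (\<lambda>xs. fst (prod_decode (f xs)))"
proof (rule recfn_comp1[where h = "\<lambda>x. fst (prod_decode x)", OF _ assms], rule recfn_graph)
  \<comment> \<open>\<open>w\<close> stands for the other component. It is at most the code of the
    pair, which makes the quantifier bounded.\<close>
  show "recpred (Suc 1) (\<lambda>xs. \<exists>w<Suc (xs ! 1). (\<lambda>ys. prod_encode (ys ! 1, ys ! 0) = ys ! 2) (w # xs))"
    by (intro recpred_ex_less[where P = "\<lambda>ys. prod_encode (ys ! 1, ys ! 0) = ys ! 2"] recfn_intros) simp_all
  show "(\<exists>w<Suc ((y # xs) ! 1). (\<lambda>ys. prod_encode (ys ! 1, ys ! 0) = ys ! 2) (w # y # xs))
      \<longleftrightarrow> y = fst (prod_decode (xs ! 0))" for y and xs :: "nat list"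
    using le_prod_encode_2[of "snd (prod_decode (xs ! 0))" "fst (prod_decode (xs ! 0))"]
    by (auto simp: prod_encode_eq_iff less_Suc_eq_le)
qed

lemma recfn_snd_prod_decode [recfn_intros]:
  assumes "recfn k f" shows "recfn k (\<lambda>xs. snd (prod_decode (f xs)))"
proof (rule recfn_comp1[where h = "\<lambda>x. snd (prod_decode x)", OF _ assms], rule recfn_graph)
  show "recpred (Suc 1) (\<lambda>xs. \<exists>w<Suc (xs ! 1). (\<lambda>ys. prod_encode (ys ! 0, ys ! 1) = ys ! 2) (w # xs))"
    by (intro recpred_ex_less[where P = "\<lambda>ys. prod_encode (ys ! 0, ys ! 1) = ys ! 2"] recfn_intros) simp_all
  show "(\<exists>w<Suc ((y # xs) ! 1). (\<lambda>ys. prod_encode (ys ! 0, ys ! 1) = ys ! 2) (w # y # xs))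
      \<longleftrightarrow> y = snd (prod_decode (xs ! 0))" for y and xs :: "nat list"
    using le_prod_encode_1[of "fst (prod_decode (xs ! 0))" "snd (prod_decode (xs ! 0))"]
    by (auto simp: prod_encode_eq_iff less_Suc_eq_le)
qed

text \<open>A finite sum of constants, each switched on by an equality test.\<close>

lemma recfn_finite_support:
  assumes "finite S" "\<And>n. n \<notin> S \<Longrightarrow> t n = 0"
  shows "recfn 1 (\<lambda>xs. t (xs ! 0))"
proof (rule recfn_cong)
  show "recfn 1 (\<lambda>xs. \<Sum>s\<in>S. if xs ! 0 = s then t s else 0)"
    using assms(1)
  proof (induction S)
    case empty
    show ?case by (simp add: recfn_const)
  next
    case (insert s S)
    have "recfn 1 (\<lambda>xs. if xs ! 0 = s then t s else 0)"
      by (intro recfn_intros) simp_all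
    from recfn_add[OF this insert.IH] show ?case
      by (simp only: sum.insert[OF insert.hyps])
  qed
qed (use assms in \<open>auto simp: sum.delta\<close>)

lemma recfn_table:
  fixes c :: "'a \<Rightarrow> nat"
  assumes "inj c" "finite (UNIV :: 'a set)"
  shows "\<exists>t. recfn 1 (\<lambda>xs. t (xs ! 0)) \<and> (\<forall>x. t (c x) = d x)"
proof (intro exI conjI)
  let ?t = "\<lambda>n. if n \<in> range c then d (inv c n) else 0"
  show "recfn 1 (\<lambda>xs. ?t (xs ! 0))"
    by (rule recfn_finite_support[of "range c"]) (use assms(2) in auto)
  show "\<forall>x. ?t (c x) = d x" using assms(1) by simp
qed

section \<open>Simulating a Turing machine\<close>

lemma finite_symbols: "finite (UNIV :: 'g::finite symbol set)"
proof -
  have "a \<in> insert Blank (range Bit \<union> range Aux)" for a :: "'g symbol"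
    by (cases a) auto
  then have "UNIV = insert Blank (range Bit \<union> range (Aux :: 'g \<Rightarrow> _))"
    by blast
  moreover have "finite (insert Blank (range Bit \<union> range (Aux :: 'g \<Rightarrow> _)))"
    by simp
  ultimately show ?thesis by (rule ssubst)
qed

text \<open>Bits get the digits that they have in \<open>str_index\<close>, so the digits of an
  index can be moved to the tape unchanged.\<close>

fun sym_code :: "'g::finite symbol \<Rightarrow> nat" where
  "sym_code Blank = 0"
| "sym_code (Bit d) = (if d then 2 else 1)"
| "sym_code (Aux g) = 3 + to_nat g"

lemma inj_sym_code: "inj sym_code"
proof (rule injI)
  show "a = b" if "sym_code a = sym_code b" for a b :: "'g::finite symbol"
    using that by (cases a; cases b) (auto split: if_splits)
qed

definition sym_base :: "'g::finite itself \<Rightarrow> nat" where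
  "sym_base _ = Suc (Max (range (sym_code :: 'g symbol \<Rightarrow> nat)))"

lemma sym_code_less_base: "sym_code (a :: 'g::finite symbol) < sym_base TYPE('g)"
  unfolding sym_base_def by (simp add: less_Suc_eq_le finite_symbols)

text \<open>There are finitely many pairs of state and symbol, so whatever depends on such a pair is
  a finite table.\<close>

lemma recfn_transition_table:
  fixes d :: "'q::finite \<times> 'g::finite symbol \<Rightarrow> nat"
  shows "\<exists>t. recfn 1 (\<lambda>xs. t (xs ! 0)) \<and> (\<forall>q a. t (prod_encode (to_nat q, sym_code a)) = d (q, a))"
proof -
  let ?c = "\<lambda>(q :: 'q, a :: 'g symbol). prod_encode (to_nat q, sym_code a)"
  have "inj ?c"
    by (rule injI) (auto simp: prod_encode_eq dest: injD[OF inj_sym_code])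
  moreover have "finite (UNIV :: ('q \<times> 'g symbol) set)"
    by (simp add: finite_prod finite_symbols)
  ultimately obtain t where "recfn 1 (\<lambda>xs. t (xs ! 0))" and "\<forall>x. t (?c x) = d x"
    using recfn_table[of ?c d] by auto
  then show ?thesis by (intro exI[of _ t]) auto
qed

text \<open>A number acts as a stack with top \<open>n mod B\<close>: multiplying by
  \<open>B\<close> and adding a digit pushes, dividing by \<open>B\<close> pops.\<close>

definition digit :: "nat \<Rightarrow> nat \<Rightarrow> nat \<Rightarrow> nat" where
  "digit B n i = n div B ^ i mod B"

lemma digit_zero [simp]: "digit B 0 i = 0"
  by (simp add: digit_def)

lemma digit_0: "digit B n 0 = n mod B"
  by (simp add: digit_def)

lemma digit_div: "digit B (n div B) i = digit B n (Suc i)"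
  by (simp add: digit_def div_mult2_eq)

lemma digit_push: "a < B \<Longrightarrow> digit B (n * B + a) i = (case i of 0 \<Rightarrow> a | Suc j \<Rightarrow> digit B n j)"
  by (cases i) (simp_all add: digit_def div_mult2_eq)

section \<open>Runs prolonged past halting by idling\<close>

definition stutter :: "('q, 'g) tm \<Rightarrow> ('q, 'g) config \<Rightarrow> ('q, 'g) config" where
  "stutter M c = (case tm_step M c of None \<Rightarrow> c | Some c' \<Rightarrow> c')"

text \<open>The time bound turns halting into a decidable predicate.\<close>

definition halted_by :: "('q, 'g) tm \<Rightarrow> bool list \<Rightarrow> nat \<Rightarrow> bool" where
  "halted_by M p k \<longleftrightarrow> (\<exists>j\<le>k. \<exists>c. halts_with M p j c)"

text \<open>A halting configuration is a fixed point of \<open>stutter\<close>. So the iteration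
  follows the run until it halts and is frozen from then on; the two alternatives are kept as an
  invariant.\<close>

lemma stutter_run:
  "(\<nexists>j c. j < k \<and> halts_with M p j c) \<and> tm_run M p k = Some ((stutter M ^^ k) (tm_init M p)) \<or>
   (\<exists>j<k. halts_with M p j ((stutter M ^^ k) (tm_init M p)))"
proof (induction k)
  case (Suc k)
  let ?c = "(stutter M ^^ k) (tm_init M p)"
  have stuck: "stutter M ?c = ?c" if "tm_step M ?c = None"
    using that by (simp add: stutter_def)
  from Suc show ?case
  proof (elim disjE conjE exE)
    assume none: "\<nexists>j c. j < k \<and> halts_with M p j c" and run: "tm_run M p k = Some ?c"
    show ?case
    proof (cases "tm_step M ?c")
      case None
      then have "halts_with M p k ?c" using run by (simp add: halts_with_def)
      then have "halts_with M p k ((stutter M ^^ Suc k) (tm_init M p))"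
        using stuck[OF None] by simp
      then show ?thesis by blast
    next
      case (Some c')
      then have "\<nexists>c. halts_with M p k c" using run by (simp add: halts_with_def)
      moreover have "tm_run M p (Suc k) = Some ((stutter M ^^ Suc k) (tm_init M p))"
        using Some run by (simp add: stutter_def)
      moreover have "\<nexists>j c. j < Suc k \<and> halts_with M p j c"
        using none calculation by (simp only: less_Suc_eq) blast
      ultimately show ?thesis by blast
    qed
  next
    fix j assume "j < k" "halts_with M p j ?c"
    moreover from this have "(stutter M ^^ Suc k) (tm_init M p) = ?c"
      using stuck by (simp add: halts_with_def)
    ultimately show ?case by (metis less_SucI)
  qed
qed simp

lemma halted_by_iff: "halted_by M p k \<longleftrightarrow> tm_step M ((stutter M ^^ k) (tm_init M p)) = None"
proof
  assume "halted_by M p k"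
  then obtain j c where j: "j \<le> k" "halts_with M p j c"
    unfolding halted_by_def by blast
  from stutter_run[of k M p] show "tm_step M ((stutter M ^^ k) (tm_init M p)) = None"
  proof (elim disjE conjE exE)
    assume "\<nexists>j c. j < k \<and> halts_with M p j c" and "tm_run M p k = Some ((stutter M ^^ k) (tm_init M p))"
    moreover from this j have "j = k" by (metis le_neq_implies_less)
    ultimately show ?thesis using j by (simp add: halts_with_def)
  qed (simp add: halts_with_def)
next
  assume "tm_step M ((stutter M ^^ k) (tm_init M p)) = None"
  with stutter_run[of k M p] show "halted_by M p k"
  proof (elim disjE conjE exE)
    assume "tm_step M ((stutter M ^^ k) (tm_init M p)) = None"
      and "tm_run M p k = Some ((stutter M ^^ k) (tm_init M p))"
    then show ?thesis unfolding halted_by_def halts_with_def by blast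
  next
    fix j assume "j < k" "halts_with M p j ((stutter M ^^ k) (tm_init M p))"
    then show ?thesis unfolding halted_by_def by (meson less_imp_le)
  qed
qed

section \<open>Arithmetic simulation of configurations\<close>

text \<open>A configuration is coded by its state and two stacks of base-\<open>B\<close> digits: the cells to the
  left of the head, and those from the head rightwards, each with the nearest cell as lowest
  digit. Blank has digit 0, so only finitely many digits are nonzero.\<close>

fun represents :: "nat \<Rightarrow> ('q::finite, 'g::finite) config \<Rightarrow> bool" where
  "represents z (q, tape, h) \<longleftrightarrow> (\<exists>L R. z = prod_encode (to_nat q, prod_encode (L, R)) \<and>
     (\<forall>i. digit (sym_base TYPE('g)) L i = sym_code (tape (h - 1 - int i))) \<and>
     (\<forall>i. digit (sym_base TYPE('g)) R i = sym_code (tape (h + int i))))"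

text \<open>The state and the top of the right stack determine the transition by table lookup; the
  rest of a step shifts one digit between the stacks.\<close>

lemma recfn_step_code:
  fixes M :: "('q::finite, 'g::finite) tm"
  shows "\<exists>next. recfn 1 (\<lambda>xs. next (xs ! 0)) \<and>
    (\<forall>z c. represents z c \<longrightarrow> represents (next z) (stutter M c))"
proof -
  let ?B = "sym_base TYPE('g)"
  \<comment> \<open>An undefined transition becomes one that changes nothing, in agreement with
    \<open>stutter\<close>.\<close>
  let ?d = "\<lambda>(q, a). case tm_delta M q a of None \<Rightarrow> (q, a, Stay) | Some x \<Rightarrow> x"
  obtain tq where tq: "recfn 1 (\<lambda>xs. tq (xs ! 0))"
      "\<And>q a. tq (prod_encode (to_nat q, sym_code a)) = to_nat (fst (?d (q, a)))"
    using recfn_transition_table[of "\<lambda>x. to_nat (fst (?d x))"]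
    by (elim exE conjE) (rule that, assumption, simp)
  obtain ta where ta: "recfn 1 (\<lambda>xs. ta (xs ! 0))"
      "\<And>q a. ta (prod_encode (to_nat q, sym_code a)) = sym_code (fst (snd (?d (q, a))))"
    using recfn_transition_table[of "\<lambda>x. sym_code (fst (snd (?d x)))"]
    by (elim exE conjE) (rule that, assumption, simp)
  obtain tm where tm: "recfn 1 (\<lambda>xs. tm (xs ! 0))"
      "\<And>q a. tm (prod_encode (to_nat q, sym_code a)) =
        (case snd (snd (?d (q, a))) of MoveLeft \<Rightarrow> 0 | Stay \<Rightarrow> 1 | MoveRight \<Rightarrow> 2)"
    using recfn_transition_table[of "\<lambda>x. (case snd (snd (?d x)) of MoveLeft \<Rightarrow> 0 | Stay \<Rightarrow> 1 | MoveRight \<Rightarrow> 2)"]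
    by (elim exE conjE) (rule that, assumption, simp)
  define left where "left z = fst (prod_decode (snd (prod_decode z)))" for z
  define right where "right z = snd (prod_decode (snd (prod_decode z)))" for z
  define key where "key z = prod_encode (fst (prod_decode z), right z mod ?B)" for z
  define new where "new z = right z div ?B * ?B + ta (key z)" for z
  \<comment> \<open>\<open>new\<close> is the right stack with the written symbol on top. A left
    move transfers the top of the left stack onto it; a right move pushes the written symbol on the
    left stack and pops the right one.\<close>
  define "next" where "next z = prod_encode (tq (key z),
      if tm (key z) = 0 then prod_encode (left z div ?B, new z * ?B + left z mod ?B)
      else if tm (key z) = 1 then prod_encode (left z, new z)
      else prod_encode (left z * ?B + ta (key z), right z div ?B))" for z
  have "recfn 1 (\<lambda>xs. next (xs ! 0))"
    unfolding next_def new_def key_def left_def right_def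
    by (intro recfn_intros recfn_comp1[OF tq(1)] recfn_comp1[OF ta(1)] recfn_comp1[OF tm(1)]) simp_all
  moreover have "represents (next z) (stutter M c)" if rep: "represents z c" for z c
  proof -
    obtain q tape h where c: "c = (q, tape, h)" by (cases c)
    obtain L R where z: "z = prod_encode (to_nat q, prod_encode (L, R))"
      and L: "\<And>i. digit ?B L i = sym_code (tape (h - 1 - int i))"
      and R: "\<And>i. digit ?B R i = sym_code (tape (h + int i))"
      using rep unfolding c by auto
    obtain q' a m where d: "?d (q, tape h) = (q', a, m)" by (cases "?d (q, tape h)")
    have st: "stutter M c = (q', tape(h := a), h + offset m)"
      using d unfolding c stutter_def by (auto split: option.splits)
    have lr: "left z = L" "right z = R" by (simp_all add: left_def right_def z)
    have key: "key z = prod_encode (to_nat q, sym_code (tape h))"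
      using R[of 0] by (simp add: key_def lr digit_0) (simp add: z)
    note t = tq(2)[of q "tape h"] ta(2)[of q "tape h"] tm(2)[of q "tape h"]
    have "tq (key z) = to_nat q'" "ta (key z) = sym_code a"
      and m: "tm (key z) = (case m of MoveLeft \<Rightarrow> 0 | Stay \<Rightarrow> 1 | MoveRight \<Rightarrow> 2)"
      using t unfolding key d by simp_all
    note nx = next_def[of z, unfolded new_def lr this(1,2) m]
    have a: "sym_code a < ?B" by (rule sym_code_less_base)
    have L0: "L mod ?B < ?B" using a by simp
    have R': "digit ?B (R div ?B * ?B + sym_code a) i = sym_code ((tape(h := a)) (h + int i))" for i
      by (cases i) (simp_all only: digit_push[OF a] nat.case digit_div R, simp_all)
    \<comment> \<open>The left stack after a right move: its top is then the cell \<open>h\<close>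
      just written.\<close>
    have L': "digit ?B (L * ?B + sym_code a) i = sym_code ((tape(h := a)) (h - int i))" for i
      by (cases i) (simp_all only: digit_push[OF a] nat.case L, simp_all add: algebra_simps)
    show ?thesis
    proof (cases m)
      case MoveLeft
      have "digit ?B (L div ?B) i = sym_code ((tape(h := a)) (h - 1 - 1 - int i))" for i
        by (simp add: digit_div L algebra_simps)
      moreover have "digit ?B ((R div ?B * ?B + sym_code a) * ?B + L mod ?B) i =
          sym_code ((tape(h := a)) (h - 1 + int i))" for i
        using L[of 0] by (cases i) (simp_all only: digit_push[OF L0] nat.case R', simp_all add: digit_0)
      ultimately show ?thesis
        unfolding st nx MoveLeft by auto
    next
      case Stay
      then show ?thesis unfolding st nx using R' L by simp
    next
      case MoveRight
      have "digit ?B (R div ?B) i = sym_code ((tape(h := a)) (h + 1 + int i))" for i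
        by (simp add: digit_div R algebra_simps)
      then show ?thesis unfolding st nx MoveRight using L' by simp
    qed
  qed
  ultimately show ?thesis by blast
qed

lemma recfn_init_code:
  fixes M :: "('q::finite, 'g::finite) tm"
  shows "\<exists>start. recfn 1 (\<lambda>xs. start (xs ! 0)) \<and>
    (\<forall>p. represents (start (str_index p)) (tm_init M p))"
proof -
  let ?B = "sym_base TYPE('g)"
  let ?code = "\<lambda>d. sym_code (Bit d :: 'g symbol)"
  let ?push = "\<lambda>d R. R * ?B + ?code d"
  \<comment> \<open>The last bit of a string is the lowest digit of its index, so moving digits off the index
    onto the right stack leaves the first bit on top, under the head.\<close>
  define pop where "pop z = (if fst (prod_decode z) = 0 then z
      else prod_encode ((fst (prod_decode z) - 1) div 2,
        snd (prod_decode z) * ?B + (if fst (prod_decode z) mod 2 = 0 then 2 else 1)))" for z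
  have pop: "recfn 1 (\<lambda>xs. pop (xs ! 0))"
    unfolding pop_def by (intro recfn_intros) simp_all
  have pop_iter: "(pop ^^ (length p + n)) (prod_encode (str_index p, R)) = prod_encode (0, foldr ?push p R)"
    for p n R
  proof (induction p arbitrary: R rule: rev_induct)
    case Nil
    show ?case by (induction n) (simp_all add: pop_def)
  next
    case (snoc d p)
    have "pop (prod_encode (str_index (p @ [d]), R)) = prod_encode (str_index p, ?push d R)"
      by (auto simp: pop_def)
    then show ?case
      using snoc.IH[of "?push d R"] by (simp add: funpow_swap1 del: str_index_snoc)
  qed
  \<comment> \<open>Once the index is 0, \<open>pop\<close> idles. Hence \<open>m\<close> iterations
    suffice, because a string is no longer than its index.\<close>
  define start where "start m = prod_encode (to_nat (tm_start M),
      prod_encode (0, snd (prod_decode ((pop ^^ m) (prod_encode (m, 0))))))" for m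
  have "recfn 1 (\<lambda>xs. start (xs ! 0))"
    unfolding start_def by (intro recfn_intros recfn_funpow[OF pop]) simp_all
  moreover have "represents (start (str_index p)) (tm_init M p)" for p
  proof -
    have len: "length p \<le> str_index p"
      by (induction p rule: rev_induct) auto
    have "start (str_index p) = prod_encode (to_nat (tm_start M), prod_encode (0, foldr ?push p 0))"
      using pop_iter[of p "str_index p - length p" 0] len by (simp add: start_def)
    moreover have "digit ?B (foldr ?push p 0) i = (if i < length p then ?code (p ! i) else 0)" for i
    proof (induction p arbitrary: i)
      case (Cons d p)
      show ?case
        by (simp only: foldr_Cons o_apply digit_push[OF sym_code_less_base] Cons.IH) (cases i; simp)
    qed simp
    ultimately show ?thesis
      by (simp add: tm_init_def)
  qed
  ultimately show ?thesis by blast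
qed

text \<open>Simulate \<open>g xs\<close> idling steps on codes, then look up whether a transition is
  defined there.\<close>

lemma recpred_halted_by:
  fixes M :: "('q::finite, 'g::finite) tm"
  assumes "recfn k f" "recfn k g"
  shows "recpred k (\<lambda>xs. halted_by M (nth_str (f xs)) (g xs))"
proof -
  let ?B = "sym_base TYPE('g)"
  obtain "next" where nx: "recfn 1 (\<lambda>xs. next (xs ! 0))"
      "\<And>z c. represents z c \<Longrightarrow> represents (next z) (stutter M c)"
    using recfn_step_code[of M] by blast
  obtain start where start: "recfn 1 (\<lambda>xs. start (xs ! 0))"
      "\<And>p. represents (start (str_index p)) (tm_init M p)"
    using recfn_init_code[of M] by blast
  obtain th where th: "recfn 1 (\<lambda>xs. th (xs ! 0))"
      "\<And>q a. th (prod_encode (to_nat q, sym_code a)) = of_bool (tm_delta M q a = None)"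
    using recfn_transition_table[of "\<lambda>(q, a). of_bool (tm_delta M q a = None)"]
    by (elim exE conjE) (rule that, assumption, simp)
  have rep: "represents ((next ^^ n) (start (str_index p))) ((stutter M ^^ n) (tm_init M p))" for n p
    by (induction n) (use start(2) nx(2) in auto)
  define key where "key z = prod_encode (fst (prod_decode z), snd (prod_decode (snd (prod_decode z))) mod ?B)" for z
  have halt: "0 < th (key z) \<longleftrightarrow> tm_step M c = None" if z: "represents z c" for z c
  proof -
    obtain q tape h where c: "c = (q, tape, h)" by (cases c)
    obtain L R where z: "z = prod_encode (to_nat q, prod_encode (L, R))"
      and R: "\<And>i. digit ?B R i = sym_code (tape (h + int i))"
      using z unfolding c by auto
    have "key z = prod_encode (to_nat q, sym_code (tape h))"
      using R[of 0] by (simp add: key_def z digit_0)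
    then show ?thesis using th(2)[of q "tape h"] by (simp add: c)
  qed
  show ?thesis
  proof (rule recpred_cong)
    show "recpred k (\<lambda>xs. 0 < th (key ((next ^^ g xs) (start (f xs)))))"
      unfolding key_def using assms
      by (intro recfn_intros recfn_comp1[OF th(1)] recfn_funpow[OF nx(1)] recfn_comp1[OF start(1)])
    show "halted_by M (nth_str (f xs)) (g xs) \<longleftrightarrow> 0 < th (key ((next ^^ g xs) (start (f xs))))" for xs
      using halt[OF rep[of "g xs" "nth_str (f xs)"]] by (simp add: halted_by_iff)
  qed
qed

section \<open>Halting and running times\<close>

lemma running_time_eq: "halts_with M p k c \<Longrightarrow> running_time M p = k"
  unfolding running_time_def by (rule the_equality) (use halts_with_unique in blast)+

lemma halted_by_iff_running_time: "halted_by M p k \<longleftrightarrow> halts M p \<and> running_time M p \<le> k"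
  unfolding halted_by_def halts_def using running_time_eq by metis

lemma halts_iff_dom:
  assumes "computes M V" shows "halts M p \<longleftrightarrow> p \<in> dom V"
  using assms[unfolded computes_def, rule_format, of p]
  by (cases "V p") (auto simp: halts_def simp del: split_paired_Ex)

text \<open>The head starts at 0 and moves at most one cell per step, so the first
  \<open>length p\<close> steps never read or write cell \<open>length p\<close>. The two runs
  differ in that cell only.\<close>

lemma tm_run_snoc:
  assumes "k \<le> length p" "tm_run M p k = Some (q, t, h)"
  shows "h \<le> int k \<and> tm_run M (p @ [x]) k = Some (q, t(int (length p) := Bit x), h)"
  using assms
proof (induction k arbitrary: q t h)
  case 0
  have "snd (snd (tm_init M p)) = 0" "fst (tm_init M p) = tm_start M" by (simp_all add: tm_init_def)
  moreover have "fst (snd (tm_init M (p @ [x]))) = (fst (snd (tm_init M p)))(int (length p) := Bit x)"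
    by (auto simp: tm_init_def fun_eq_iff nth_append)
  ultimately show ?case
    using 0 by (auto simp: tm_init_def)
next
  case (Suc k)
  obtain q' t' h' where run: "tm_run M p k = Some (q', t', h')"
    and step: "tm_step M (q', t', h') = Some (q, t, h)"
    using Suc.prems(2) by (auto simp: bind_eq_Some_conv simp del: tm_step.simps)
  have IH: "h' \<le> int k" "tm_run M (p @ [x]) k = Some (q', t'(int (length p) := Bit x), h')"
    using Suc.IH[OF _ run] Suc.prems(1) by auto
  then have "h' \<noteq> int (length p)" using Suc.prems(1) by simp
  then have "tm_step M (q', t'(int (length p) := Bit x), h') = Some (q, t(int (length p) := Bit x), h)"
    using step by (auto simp: fun_upd_twist)
  moreover have "h \<le> int (Suc k)"
  proof -
    obtain m where "h = h' + offset m" using step by auto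
    then show ?thesis using IH(1) by (cases m) auto
  qed
  ultimately show ?case using IH(2) by (simp add: fun_upd_def del: tm_step.simps)
qed

text \<open>A machine that halts before its head has passed the end of the input also halts on every
  one-bit extension, against prefix-freeness.\<close>

lemma length_le_running_time:
  assumes "computes M V" "prefix_free (dom V)" "halts M p"
  shows "length p \<le> running_time M p"
proof (rule ccontr)
  assume less: "\<not> length p \<le> running_time M p"
  obtain k c where k: "halts_with M p k c" using assms(3) unfolding halts_def by blast
  obtain q t h where c: "c = (q, t, h)" by (cases c)
  have kp: "k < length p" using less running_time_eq[OF k] by simp
  have "tm_run M p k = Some (q, t, h)" using k by (simp add: halts_with_def c)
  from tm_run_snoc[OF _ this, of False] kp
  have h: "h \<le> int k" and run: "tm_run M (p @ [False]) k = Some (q, t(int (length p) := Bit False), h)"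
    by simp_all
  have "halts_with M (p @ [False]) k (q, t(int (length p) := Bit False), h)"
    using run k h kp by (simp add: halts_with_def c)
  then have "halts M (p @ [False])" unfolding halts_def by blast
  then have "p = p @ [False]"
    using assms unfolding halts_iff_dom[OF assms(1)] prefix_free_def by (metis prefixI)
  then show False by simp
qed

section \<open>Recursive functions on strings\<close>

text \<open>\<open>Suc (str_index s)\<close> has the binary expansion 1 followed by
  \<open>s\<close>.\<close>

lemma str_index_bounds: "2 ^ length s \<le> Suc (str_index s) \<and> Suc (str_index s) < 2 ^ Suc (length s)"
  by (induction s rule: rev_induct) auto

lemma recfn_length_nth_str [recfn_intros]:
  assumes "recfn k f" shows "recfn k (\<lambda>xs. length (nth_str (f xs)))"
proof (rule recfn_comp1[where h = "\<lambda>m. length (nth_str m)", OF _ assms], rule recfn_graph)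
  show "recpred (Suc 1) (\<lambda>xs. 2 ^ (xs ! 0) \<le> Suc (xs ! 1) \<and> Suc (xs ! 1) < 2 ^ Suc (xs ! 0))"
    by (intro recfn_intros) simp_all
  have "2 ^ y \<le> Suc m \<and> Suc m < 2 ^ Suc y \<longleftrightarrow> y = length (nth_str m)" for y m
  proof
    assume y: "2 ^ y \<le> Suc m \<and> Suc m < 2 ^ Suc y"
    have l: "2 ^ length (nth_str m) \<le> Suc m \<and> Suc m < 2 ^ Suc (length (nth_str m))"
      using str_index_bounds[of "nth_str m"] by simp
    have "(2::nat) ^ y < 2 ^ Suc (length (nth_str m))" "(2::nat) ^ length (nth_str m) < 2 ^ Suc y"
      using y l by linarith+
    then show "y = length (nth_str m)"
      by (simp only: power_strict_increasing_iff)
  qed (use str_index_bounds[of "nth_str m"] in auto)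
  then show "2 ^ ((y # xs) ! 0) \<le> Suc ((y # xs) ! 1) \<and> Suc ((y # xs) ! 1) < 2 ^ Suc ((y # xs) ! 0)
      \<longleftrightarrow> y = length (nth_str (xs ! 0))" for y xs
    by simp
qed

section \<open>Computers and functions derived from \<open>M\<close> and \<open>V\<close>\<close>

lemma computer_map:
  assumes "computer U" "recfn 1 (\<lambda>xs. g (xs ! 0))"
  shows "computer (\<lambda>p. map_option (\<lambda>s. nth_str (g (str_index s))) (U p))"
proof -
  obtain eU where eU: "\<And>p. rec_eval eU [str_index p] = map_option str_index (U p)"
    using assms(1) unfolding computer_def partial_recursive_def by blast
  obtain eg where eg: "\<And>xs. length xs = 1 \<Longrightarrow> rec_eval eg xs = Some (g (xs ! 0))"
    using assms(2) unfolding recfn_def by blast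
  have "rec_eval (Comp eg [eU]) [str_index p] =
      map_option str_index (map_option (\<lambda>s. nth_str (g (str_index s))) (U p))" for p
    by (cases "U p") (simp_all add: eU eg)
  then have "partial_recursive (\<lambda>p. map_option (\<lambda>s. nth_str (g (str_index s))) (U p))"
    unfolding partial_recursive_def by blast
  \<comment> \<open>Total postprocessing keeps the domain, and with it prefix-freeness.\<close>
  moreover have "dom (\<lambda>p. map_option (\<lambda>s. nth_str (g (str_index s))) (U p)) = dom U"
    by auto
  ultimately show ?thesis
    using assms(1) by (simp add: computer_def)
qed

text \<open>Unbounded search over \<open>halted_by\<close> finds the running time and diverges
  exactly where \<open>M\<close> does. So the domain is that of \<open>V\<close> and
  prefix-free.\<close>

lemma computer_running_time:
  fixes M :: "('q::finite, 'g::finite) tm"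
  assumes "computer V" "computes M V" "recfn 2 (\<lambda>xs. g (xs ! 0) (xs ! 1))"
  shows "computer (\<lambda>p. if halts M p then Some (nth_str (g (running_time M p) (length p))) else None)"
proof -
  have "recpred (Suc 1) (\<lambda>xs. halted_by M (nth_str (xs ! 1)) (xs ! 0))"
    by (intro recpred_halted_by recfn_intros) simp_all
  from rec_eval_Mu_recpred[OF this] obtain eR where
    eR: "\<And>xs. length xs = 1 \<Longrightarrow> rec_eval eR xs = 
      (if \<exists>y. halted_by M (nth_str ((y # xs) ! 1)) ((y # xs) ! 0)
       then Some (LEAST y. halted_by M (nth_str ((y # xs) ! 1)) ((y # xs) ! 0)) else None)"
    by blast
  have eR': "rec_eval eR [str_index p] = (if halts M p then Some (running_time M p) else None)" for p
    using eR[of "[str_index p]"] by (auto simp: halted_by_iff_running_time Least_equality)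
  have "recfn 2 (\<lambda>xs. g (xs ! 0) (length (nth_str (xs ! 1))))"
    by (intro recfn_comp2[OF assms(3)] recfn_intros) simp_all
  then obtain eg where eg: "\<And>xs. length xs = 2 \<Longrightarrow>
      rec_eval eg xs = Some (g (xs ! 0) (length (nth_str (xs ! 1))))"
    unfolding recfn_def by blast
  let ?C = "\<lambda>p. if halts M p then Some (nth_str (g (running_time M p) (length p))) else None"
  have "rec_eval (Comp eg [eR, Proj 0]) [str_index p] = map_option str_index (?C p)" for p
    by (simp add: eR' eg)
  then have "partial_recursive ?C"
    unfolding partial_recursive_def by blast
  moreover have "dom ?C = dom V"
    using halts_iff_dom[OF assms(2)] by (auto split: if_splits)
  ultimately show ?thesis
    using assms(1) by (simp add: computer_def)
qed

text \<open>Optimality applied to this computer provides a halting program of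
  \<open>V\<close>.\<close>

lemma computer_singleton: "computer [[] \<mapsto> []]"
proof -
  have "recpred (Suc 1) (\<lambda>xs. xs ! 1 = 0 \<and> xs ! 0 = 0)"
    by (intro recfn_intros) simp_all
  from rec_eval_Mu_recpred[OF this] obtain e where
    e: "\<And>xs. length xs = 1 \<Longrightarrow> rec_eval e xs =
      (if \<exists>y. (y # xs) ! 1 = 0 \<and> (y # xs) ! 0 = 0
       then Some (LEAST y. (y # xs) ! 1 = 0 \<and> (y # xs) ! 0 = 0) else None)"
    by blast
  have "rec_eval e [str_index p] = map_option str_index ([[] \<mapsto> []] p)" for p
    using e[of "[str_index p]"] inj_eq[OF inj_str_index, of p "[]"]
    by (auto simp: Least_equality)
  then have "partial_recursive [[] \<mapsto> []]"
    unfolding partial_recursive_def by blast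
  then show ?thesis by (simp add: computer_def prefix_free_def)
qed

lemma recfn_outputs_of_halting:
  fixes M :: "('q::finite, 'g::finite) tm"
  assumes "computer V" "computes M V"
  shows "recfn 2 (\<lambda>xs. if halted_by M (nth_str (xs ! 0)) (xs ! 1)
    then str_index (the (V (nth_str (xs ! 0)))) else 0)"
proof -
  obtain e where e: "\<And>p. rec_eval e [str_index p] = map_option str_index (V p)"
    using assms(1) unfolding computer_def partial_recursive_def by blast
  have "recpred 2 (\<lambda>xs. halted_by M (nth_str (xs ! 0)) (xs ! 1))"
    by (intro recpred_halted_by recfn_intros) simp_all
  then obtain eh where eh: "\<And>xs. length xs = 2 \<Longrightarrow>
      rec_eval eh xs = Some (of_bool (halted_by M (nth_str (xs ! 0)) (xs ! 1)))"
    unfolding recpred_def recfn_def by blast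
  \<comment> \<open>The partial \<open>e\<close> may be evaluated only on halting programs. With the
    truth value as recursion argument, 0 yields \<open>Zero\<close> without touching
    \<open>e\<close>, and 1 runs \<open>e\<close> once on the program, which is
    \<open>Proj 2\<close> in the step.\<close>
  have "rec_eval (Comp (PrimRec Zero (Comp e [Proj 2])) [eh, Proj 0]) xs =
      Some (if halted_by M (nth_str (xs ! 0)) (xs ! 1)
        then str_index (the (V (nth_str (xs ! 0)))) else 0)" if "length xs = 2" for xs
  proof (cases "halted_by M (nth_str (xs ! 0)) (xs ! 1)")
    case True
    then obtain s where s: "V (nth_str (xs ! 0)) = Some s"
      using halts_iff_dom[OF assms(2)] by (auto simp: halted_by_iff_running_time)
    show ?thesis
      using True eh[OF that] that e[of "nth_str (xs ! 0)"] s by (simp add: numeral_2_eq_2)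
  next
    case False
    then show ?thesis using eh[OF that] that by simp
  qed
  then show ?thesis unfolding recfn_def by blast
qed

lemma recfn_above_outputs:
  fixes M :: "('q::finite, 'g::finite) tm"
  assumes "computer V" "computes M V"
  shows "\<exists>G. recfn 1 (\<lambda>xs. G (xs ! 0)) \<and> (\<forall>N p s. V p = Some s \<longrightarrow>
    running_time M p \<le> N \<longrightarrow> length p \<le> N \<longrightarrow> str_index s < G N)"
proof (intro exI conjI allI impI)
  let ?out = "\<lambda>xs. if halted_by M (nth_str (xs ! 0)) (xs ! 1)
    then str_index (the (V (nth_str (xs ! 0)))) else 0"
  \<comment> \<open>A sum dominates each of its terms, and \<open>Suc\<close> makes this strict. All
    strings of length at most \<open>N\<close> have index below \<open>2 ^ Suc N\<close>.\<close>
  let ?G = "\<lambda>N. Suc (\<Sum>i<2 ^ Suc N. if halted_by M (nth_str i) N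
    then str_index (the (V (nth_str i))) else 0)"
  have out: "recfn (Suc 1) ?out"
    using recfn_outputs_of_halting[OF assms] by (simp only: numeral_2_eq_2 One_nat_def)
  have "recfn 1 (\<lambda>xs. 2 ^ Suc (xs ! 0))"
    by (intro recfn_intros) simp
  from recfn_Suc[OF recfn_sum[OF out this]]
  have "recfn 1 (\<lambda>xs. Suc (\<Sum>i<2 ^ Suc (xs ! 0). ?out (i # xs)))" .
  then show "recfn 1 (\<lambda>xs. ?G (xs ! 0))"
    by (simp cong: if_cong)
  fix N p s assume p: "V p = Some s" "running_time M p \<le> N" "length p \<le> N"
  have "Suc (str_index p) < 2 ^ Suc (length p)" using str_index_bounds by blast
  also have "\<dots> \<le> 2 ^ Suc N" using p(3) by (intro power_increasing) auto
  finally have "str_index p \<in> {..<2 ^ Suc N}" by simp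
  then have "(if halted_by M (nth_str (str_index p)) N
      then str_index (the (V (nth_str (str_index p)))) else 0) < ?G N"
    unfolding less_Suc_eq_le by (intro member_le_sum) auto
  moreover have "halted_by M p N"
    using p halts_iff_dom[OF assms(2), of p] by (auto simp: halted_by_iff_running_time)
  ultimately show "str_index s < ?G N" by (simp add: p(1))
qed

section \<open>Complexity bounds\<close>

lemma complexity_le: "U q = Some s \<Longrightarrow> complexity U s \<le> length q"
  unfolding complexity_def by (rule Least_le) blast

lemma complexity_attained:
  assumes "U q = Some s" shows "\<exists>p. U p = Some s \<and> length p = complexity U s"
  unfolding complexity_def by (rule LeastI[where P = "\<lambda>k. \<exists>p. U p = Some s \<and> length p = k"]) (use assms in blast)

lemma optimalE:
  assumes "optimal U" "computer C"
  obtains d where "\<And>p s. C p = Some s \<Longrightarrow> \<exists>q. U q = Some s \<and> length q \<le> length p + d"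
  using assms unfolding optimal_def by (metis domI)

text \<open>From \<open>y\<close> one computes a string beyond all outputs of programs of length at
  most \<open>n\<close>. A shortest \<open>U\<close>-program for \<open>y\<close> thus yields a
  \<open>V\<close>-program for that string, at most \<open>d\<close> longer, which must be longer
  than \<open>n\<close>. The computer involved is independent of \<open>n\<close>, hence so is
  \<open>d\<close>.\<close>

lemma less_complexity_of_time_bound:
  fixes M :: "('q::finite, 'g::finite) tm"
  assumes "computer U" "optimal V" "computes M V" "recfn 1 (\<lambda>xs. f (xs ! 0))"
  shows "\<exists>d. \<forall>q y n. U q = Some y \<longrightarrow>
    (\<forall>p. halts M p \<longrightarrow> length p \<le> n \<longrightarrow> max (running_time M p) (length p) \<le> f (str_index y)) \<longrightarrow>
    n < complexity U y + d"
proof -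
  have V: "computer V" using assms(2) by (simp add: optimal_def)
  obtain G where G: "recfn 1 (\<lambda>xs. G (xs ! 0))"
    and above: "\<And>N p s. V p = Some s \<Longrightarrow> running_time M p \<le> N \<Longrightarrow> length p \<le> N \<Longrightarrow> str_index s < G N"
    using recfn_above_outputs[OF V assms(3)] by blast
  have "computer (\<lambda>p. map_option (\<lambda>s. nth_str (G (f (str_index s)))) (U p))"
    by (rule computer_map[OF assms(1)]) (rule recfn_comp1[OF G assms(4)])
  then obtain d where d: "\<And>p s. map_option (\<lambda>s. nth_str (G (f (str_index s)))) (U p) = Some s \<Longrightarrow>
      \<exists>q. V q = Some s \<and> length q \<le> length p + d"
    using optimalE[OF assms(2)] by blast
  have "n < complexity U y + d"
    if q: "U q = Some y"
      and time: "\<And>p. halts M p \<Longrightarrow> length p \<le> n \<Longrightarrow> max (running_time M p) (length p) \<le> f (str_index y)"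
    for q y n
  proof -
    obtain p where p: "U p = Some y" "length p = complexity U y"
      using complexity_attained[of U, OF q] by blast
    obtain r where r: "V r = Some (nth_str (G (f (str_index y))))" "length r \<le> length p + d"
      using d[of p] p(1) by auto
    have "\<not> length r \<le> n"
    proof
      assume "length r \<le> n"
      moreover have "halts M r" using r(1) by (auto simp: halts_iff_dom[OF assms(3)])
      ultimately have "max (running_time M r) (length r) \<le> f (str_index y)"
        by (intro time)
      with above[OF r(1), of "f (str_index y)"] show False by simp
    qed
    then show ?thesis using r(2) p(2) by simp
  qed
  then show ?thesis by blast
qed

section \<open>Codes of pairs\<close>

lemma recfn_total_recursive2:
  assumes "total_recursive2 b"
  shows "recfn 2 (\<lambda>xs. str_index (b (nth_str (xs ! 0), nth_str (xs ! 1))))"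
proof -
  obtain e where e: "\<And>s t. rec_eval e [str_index s, str_index t] = Some (str_index (b (s, t)))"
    using assms unfolding total_recursive2_def by blast
  have "rec_eval e xs = Some (str_index (b (nth_str (xs ! 0), nth_str (xs ! 1))))"
    if "length xs = 2" for xs
  proof -
    have "xs = [xs ! 0, xs ! 1]" using that by (auto simp: length_Suc_conv numeral_2_eq_2)
    then show ?thesis
      using e[of "nth_str (xs ! 0)" "nth_str (xs ! 1)"] by (metis str_index_nth_str)
  qed
  then show ?thesis unfolding recfn_def by blast
qed

text \<open>\<open>B\<close> searches for the least \<open>N\<close> such that some pair with
  components up to \<open>N\<close> has the given code. Surjectivity of \<open>b\<close> makes the
  search succeed; injectivity makes the pair found the right one.\<close>

lemma recfn_code_bound:
  assumes "bij b" "total_recursive2 b"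
  shows "\<exists>B. recfn 1 (\<lambda>xs. B (xs ! 0)) \<and>
    (\<forall>s t. max (str_index s) (str_index t) \<le> B (str_index (b (s, t))))"
proof -
  define c where "c m n = str_index (b (nth_str m, nth_str n))" for m n
  have c_inj: "m = m' \<and> n = n'" if "c m n = c m' n'" for m n m' n'
  proof -
    have "b (nth_str m, nth_str n) = b (nth_str m', nth_str n')"
      using that injD[OF inj_str_index] unfolding c_def by blast
    then have "nth_str m = nth_str m'" "nth_str n = nth_str n'"
      using bij_is_inj[OF assms(1)] by (auto dest: injD)
    then show ?thesis by (metis str_index_nth_str)
  qed
  have c_surj: "\<exists>m n. c m n = y" for y
  proof -
    obtain s t where "b (s, t) = nth_str y"
      using bij_is_surj[OF assms(1)] by (metis surj_def surj_pair)
    then show ?thesis by (metis c_def nth_str_str_index str_index_nth_str)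
  qed
  have c: "recfn 2 (\<lambda>xs. c (xs ! 0) (xs ! 1))"
    unfolding c_def by (rule recfn_total_recursive2[OF assms(2)])
  \<comment> \<open>The full argument list is \<open>[n, m, N, y]\<close>; each quantifier removes
    its head.\<close>
  let ?P1 = "\<lambda>ys. c (ys ! 1) (ys ! 0) = ys ! 3"
  let ?P2 = "\<lambda>ys. \<exists>n<Suc (ys ! 1). ?P1 (n # ys)"
  let ?P3 = "\<lambda>ys. \<exists>m<Suc (ys ! 0). ?P2 (m # ys)"
  have "recpred (Suc (Suc (Suc 1))) ?P1"
    by (intro recfn_intros recfn_comp2[OF c]) simp_all
  then have "recpred (Suc (Suc 1)) ?P2"
    by (rule recpred_ex_less) (intro recfn_intros, simp)
  then have P3: "recpred (Suc 1) ?P3"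
    by (rule recpred_ex_less) (intro recfn_intros, simp)
  have "recfn 1 (\<lambda>xs. LEAST N. ?P3 (N # xs))"
  proof (rule recfn_Least[OF P3])
    fix xs :: "nat list"
    obtain m n where "c m n = xs ! 0" using c_surj by blast
    then show "\<exists>N. ?P3 (N # xs)"
      by (intro exI[of _ "max m n"] exI[of _ m] conjI exI[of _ n]) (auto simp: numeral_3_eq_3)
  qed
  then have "recfn 1 (\<lambda>xs. LEAST N. \<exists>m<Suc N. \<exists>n<Suc N. c m n = xs ! 0)"
    by (simp add: numeral_3_eq_3)
  moreover have "max (str_index s) (str_index t)
      \<le> (LEAST N. \<exists>m<Suc N. \<exists>n<Suc N. c m n = str_index (b (s, t)))" for s t
  proof (rule LeastI2_ex)
    have "c (str_index s) (str_index t) = str_index (b (s, t))" by (simp add: c_def)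
    then show "\<exists>N. \<exists>m<Suc N. \<exists>n<Suc N. c m n = str_index (b (s, t))"
      by (intro exI[of _ "max (str_index s) (str_index t)"] exI[of _ "str_index s"] conjI
          exI[of _ "str_index t"]) auto
    fix N assume "\<exists>m<Suc N. \<exists>n<Suc N. c m n = str_index (b (s, t))"
    then obtain m n where mn: "m < Suc N" "n < Suc N" "c m n = c (str_index s) (str_index t)"
      by (auto simp: c_def)
    with c_inj[OF mn(3)] show "max (str_index s) (str_index t) \<le> N" by simp
  qed
  ultimately show ?thesis
    by (intro exI[of _ "\<lambda>y. LEAST N. \<exists>m<Suc N. \<exists>n<Suc N. c m n = y"]) simp
qed

text \<open>There are finitely many strings of length at most \<open>n\<close>, and
  \<open>p0\<close> makes the minimal halting length genuine, so \<open>Max\<close> ranges over a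
  finite nonempty set.\<close>

lemma max_running_time_attained:
  fixes M :: "('q, 'g) tm"
  assumes "halts M p0" "min_halting_length M \<le> n"
  shows "\<exists>p. halts M p \<and> length p \<le> n \<and> running_time M p = max_running_time M n"
    and "\<And>p. halts M p \<Longrightarrow> length p \<le> n \<Longrightarrow> running_time M p \<le> max_running_time M n"
proof -
  let ?S = "{p. halts M p \<and> length p \<le> n}"
  have fin: "finite ?S"
    by (rule finite_subset[OF _ finite_lists_length_le[of "UNIV :: bool set" n]]) auto
  have "\<exists>p. halts M p \<and> length p = min_halting_length M"
    unfolding min_halting_length_def
    by (rule LeastI[where P = "\<lambda>l. \<exists>p. halts M p \<and> length p = l"]) (use assms(1) in blast)
  then have "?S \<noteq> {}" using assms(2) by auto
  then have "max_running_time M n \<in> running_time M ` ?S"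
    unfolding max_running_time_def using fin by (intro Max_in) auto
  then show "\<exists>p. halts M p \<and> length p \<le> n \<and> running_time M p = max_running_time M n"
    by auto
  show "running_time M p \<le> max_running_time M n" if "halts M p" "length p \<le> n" for p
    unfolding max_running_time_def using fin that by (intro Max_ge) auto
qed

section \<open>Combining the bounds into one constant\<close>

theorem theorem3p9:
  fixes U V :: "bool list \<rightharpoonup> bool list"
    and b :: "bool list \<times> bool list \<Rightarrow> bool list"
    and M :: "('q::finite, 'g::finite) tm"
  assumes "optimal U"
    and "bij b" and "total_recursive2 b"
    and "optimal V"
    and "computes M V"
  shows "\<exists>C::int. \<forall>n\<ge>min_halting_length M.
           \<bar>int n - int (pair_complexity U b (nth_str (max_running_time M n)) (nth_str n))\<bar> \<le> C \<and>
           \<bar>int n - int (complexity U (nth_str (max_running_time M n)))\<bar> \<le> C"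
proof -
  have U: "computer U" and V: "computer V" using assms(1,4) by (simp_all add: optimal_def)
  let ?T = "max_running_time M"
  obtain p0 where "V p0 = Some []"
    using optimalE[OF assms(4) computer_singleton] by (metis fun_upd_same)
  then have p0: "halts M p0" using halts_iff_dom[OF assms(5)] by blast
  note attained = max_running_time_attained(1)[OF p0]
  note maximal = max_running_time_attained(2)[OF p0]

  have "computer (\<lambda>p. if halts M p then Some (nth_str (running_time M p)) else None)"
    by (rule computer_running_time[OF V assms(5), where g = "\<lambda>r l. r"]) (rule recfn_nth, simp)
  then obtain d1 where "\<And>p s. (if halts M p then Some (nth_str (running_time M p)) else None) = Some s \<Longrightarrow>
      \<exists>q. U q = Some s \<and> length q \<le> length p + d1"
    by (rule optimalE[OF assms(1)]) blast
  then have d1: "\<exists>q. U q = Some (nth_str (running_time M p)) \<and> length q \<le> length p + d1"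
    if "halts M p" for p
    using that by simp

  \<comment> \<open>The identity serves as time bound: the string \<open>y\<close> is
    \<open>T\<^sub>n\<close> itself.\<close>
  have "recfn 1 (\<lambda>xs. xs ! 0)" by (rule recfn_nth) simp
  from less_complexity_of_time_bound[OF U assms(4,5) this]
  obtain d2 where d2: "\<And>q y n. U q = Some y \<Longrightarrow>
      (\<And>p. halts M p \<Longrightarrow> length p \<le> n \<Longrightarrow> max (running_time M p) (length p) \<le> str_index y) \<Longrightarrow>
      n < complexity U y + d2"
    by blast

  \<comment> \<open>The upper bound is stated with \<open>length p\<close> instead of
    \<open>n\<close>; together the two bounds also force \<open>length p\<close> to be close to
    \<open>n\<close>.\<close>
  have single: "n < complexity U (nth_str (?T n)) + d2 \<and> complexity U (nth_str (?T n)) \<le> length p + d1"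
    if n: "min_halting_length M \<le> n" and p: "halts M p" "running_time M p = ?T n" for n p
  proof -
    obtain q where q: "U q = Some (nth_str (?T n))" "length q \<le> length p + d1"
      using d1[OF p(1)] p(2) by auto
    have "n < complexity U (nth_str (?T n)) + d2"
    proof (rule d2[OF q(1)])
      \<comment> \<open>Lengths are at most running times by prefix-freeness, and these are at most
        \<open>T\<^sub>n\<close>.\<close>
      show "max (running_time M p) (length p) \<le> str_index (nth_str (?T n))"
        if p: "halts M p" "length p \<le> n" for p
        using maximal[OF n p] length_le_running_time[OF assms(5) _ p(1)] V
        by (simp add: computer_def)
    qed
    then show ?thesis using complexity_le[of U, OF q(1)] q(2) by simp
  qed

  \<comment> \<open>A program determines only its own length, so \<open>n\<close> is supplied
    through the fixed difference \<open>j\<close>; the constant depends on \<open>j\<close>.\<close>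
  have "\<exists>d. \<forall>p. halts M p \<longrightarrow> (\<exists>q. U q = Some (b (nth_str (running_time M p), nth_str (length p + j)))
      \<and> length q \<le> length p + d)" for j
  proof -
    let ?g = "\<lambda>r l. str_index (b (nth_str r, nth_str (l + j)))"
    have "recfn 2 (\<lambda>xs. ?g (xs ! 0) (xs ! 1))"
      by (rule recfn_comp2[where h = "\<lambda>x y. str_index (b (nth_str x, nth_str y))",
            OF recfn_total_recursive2[OF assms(3)]])
        (intro recfn_intros; simp)+
    from computer_running_time[OF V assms(5) this]
    have "computer (\<lambda>p. if halts M p
        then Some (b (nth_str (running_time M p), nth_str (length p + j))) else None)"
      by (simp cong: if_cong)
    then obtain d where d: "\<And>p s. (if halts M p
        then Some (b (nth_str (running_time M p), nth_str (length p + j))) else None) = Some s \<Longrightarrow>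
        \<exists>q. U q = Some s \<and> length q \<le> length p + d"
      by (rule optimalE[OF assms(1)]) blast
    show ?thesis
      by (intro exI[of _ d] allI impI d) simp
  qed
  then obtain D where D: "\<And>j p. halts M p \<Longrightarrow>
      \<exists>q. U q = Some (b (nth_str (running_time M p), nth_str (length p + j))) \<and> length q \<le> length p + D j"
    by metis

  obtain B where B: "recfn 1 (\<lambda>xs. B (xs ! 0))"
      "\<And>s t. max (str_index s) (str_index t) \<le> B (str_index (b (s, t)))"
    using recfn_code_bound[OF assms(2,3)] by blast
  from less_complexity_of_time_bound[OF U assms(4,5) B(1)]
  obtain d3 where d3: "\<And>q y n. U q = Some y \<Longrightarrow>
      (\<And>p. halts M p \<Longrightarrow> length p \<le> n \<Longrightarrow> max (running_time M p) (length p) \<le> B (str_index y)) \<Longrightarrow>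
      n < complexity U y + d3"
    by blast

  \<comment> \<open>Only differences up to \<open>d1 + d2\<close> occur, so a maximum over finitely
    many \<open>D j\<close> suffices.\<close>
  let ?C = "d1 + d2 + d3 + Max (D ` {..d1 + d2})"
  have "\<bar>int n - int (pair_complexity U b (nth_str (?T n)) (nth_str n))\<bar> \<le> int ?C \<and>
      \<bar>int n - int (complexity U (nth_str (?T n)))\<bar> \<le> int ?C"
    if n: "min_halting_length M \<le> n" for n
  proof -
    obtain p where p: "halts M p" "length p \<le> n" "running_time M p = ?T n"
      using attained[OF n] by blast
    let ?y = "b (nth_str (?T n), nth_str n)"
    have s: "n < complexity U (nth_str (?T n)) + d2" "complexity U (nth_str (?T n)) \<le> length p + d1"
      using single[OF n p(1,3)] by auto
    define j where "j = n - length p"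
    \<comment> \<open>From \<open>n < H(T\<^sub>n) + d2\<close> and
      \<open>H(T\<^sub>n) \<le> length p + d1\<close>.\<close>
    have j: "length p + j = n" "j \<le> d1 + d2" using s p(2) by (simp_all add: j_def)
    obtain q where q: "U q = Some ?y" "length q \<le> length p + D j"
      using D[OF p(1), of j] unfolding j(1) p(3) by blast
    have "D j \<le> Max (D ` {..d1 + d2})" using j(2) by (intro Max_ge) auto
    then have upper: "complexity U ?y \<le> n + Max (D ` {..d1 + d2})"
      using complexity_le[of U, OF q(1)] q(2) p(2) by linarith
    have "n < complexity U ?y + d3"
    proof (rule d3[OF q(1)])
      \<comment> \<open>The first component of the pair bounds the running times, the second one,
        \<open>n\<close>, the lengths.\<close>
      show "max (running_time M p) (length p) \<le> B (str_index ?y)" if p: "halts M p" "length p \<le> n" for p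
        using maximal[OF n p] p(2) B(2)[of "nth_str (?T n)" "nth_str n"] by simp
    qed
    then show ?thesis
      using upper s p(2) unfolding pair_complexity_def by (intro conjI; linarith)
  qed
  then show ?thesis by blast
qed

end
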